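(* Let $R=\bigoplus_{\alpha\in\Gamma}R_{\alpha}$ be a graded integral domain. Then $R$ is a graded-Prüfer domain if and only if $A_fA_g=A_{fg}$ for all $f,g\in R[X]$.
   Context: $\Gamma$ is a commutative cancellative monoid (written additively) whose quotient group $\langle\Gamma\rangle$ is torsion-free. A graded integral domain $R=\bigoplus_{\alpha\in\Gamma}R_\alpha$ is an integral domain that is the direct sum of additive subgroups $R_\alpha$ with $R_\alpha R_\beta\subseteq R_{\alpha+\beta}$. For $a\in R$, $C(a)$ is the ideal of $R$ generated by the homogeneous components of $a$; for $f=f_0+\cdots+f_nX^n\in R[X]$, $A_f:=\sum_i C(f_i)$. $R$ is a graded-Prüfer domain if every nonzero finitely generated homogeneous ideal of $R$ (i.e. ideal $I$ with $I=\bigoplus_\alpha(I\cap R_\alpha)$) is invertible. *)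

theory Defs
  imports "HOL-Computational_Algebra.Polynomial" "HOL-Computational_Algebra.Fraction_Field"
begin

definition nsum_of :: "nat \<Rightarrow> 'g::comm_monoid_add \<Rightarrow> 'g" where
  "nsum_of n a = (\<Sum>i<n. a)"

text \<open>For a commutative cancellative monoid, the quotient group is torsion-free iff
  n a = n b with n > 0 implies a = b.\<close>
definition torsionfree_quotient :: "'g::cancel_comm_monoid_add itself \<Rightarrow> bool" where
  "torsionfree_quotient _ \<longleftrightarrow>
     (\<forall>n::nat. \<forall>a b::'g. n > 0 \<longrightarrow> nsum_of n a = nsum_of n b \<longrightarrow> a = b)"

definition is_ideal :: "('a::comm_ring_1) set \<Rightarrow> bool" where
  "is_ideal I \<longleftrightarrow> 0 \<in> I \<and> (\<forall>x\<in>I. \<forall>y\<in>I. x + y \<in> I) \<and> (\<forall>r. \<forall>x\<in>I. r * x \<in> I)"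

definition ideal_gen :: "('a::comm_ring_1) set \<Rightarrow> 'a set" where
  "ideal_gen S = {x. \<exists>F c. finite F \<and> F \<subseteq> S \<and> x = (\<Sum>s\<in>F. c s * s)}"

definition ideal_prod :: "('a::comm_ring_1) set \<Rightarrow> 'a set \<Rightarrow> 'a set" where
  "ideal_prod I J = ideal_gen {a * b | a b. a \<in> I \<and> b \<in> J}"

definition fin_gen_ideal :: "('a::comm_ring_1) set \<Rightarrow> bool" where
  "fin_gen_ideal I \<longleftrightarrow> (\<exists>S. finite S \<and> I = ideal_gen S)"

definition embR :: "'a::idom \<Rightarrow> 'a fract" where
  "embR r = Fract r 1"

definition fractional_ideal :: "('a::idom) fract set \<Rightarrow> bool" where
  "fractional_ideal J \<longleftrightarrow> 0 \<in> J \<and> (\<forall>x\<in>J. \<forall>y\<in>J. x + y \<in> J)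
     \<and> (\<forall>r. \<forall>x\<in>J. embR r * x \<in> J)
     \<and> (\<exists>d. d \<noteq> 0 \<and> (\<forall>x\<in>J. embR d * x \<in> range embR))"

definition frac_prod :: "('a::idom) set \<Rightarrow> 'a fract set \<Rightarrow> 'a fract set" where
  "frac_prod I J = {z. \<exists>(F::nat set) a b. finite F \<and> (\<forall>i\<in>F. a i \<in> I \<and> b i \<in> J)
                          \<and> z = (\<Sum>i\<in>F. embR (a i) * b i)}"

definition invertible_ideal :: "('a::idom) set \<Rightarrow> bool" where
  "invertible_ideal I \<longleftrightarrow> (\<exists>J. fractional_ideal J \<and> frac_prod I J = range embR)"

text \<open>The whole type 'a is the integral domain R; Rg \<alpha> is the component R_\<alpha>.\<close>
definition graded_idom :: "('g::cancel_comm_monoid_add \<Rightarrow> ('a::idom) set) \<Rightarrow> bool" where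
  "graded_idom Rg \<longleftrightarrow>
     torsionfree_quotient TYPE('g)
     \<and> (\<forall>\<alpha>. 0 \<in> Rg \<alpha> \<and> (\<forall>x\<in>Rg \<alpha>. \<forall>y\<in>Rg \<alpha>. x + y \<in> Rg \<alpha> \<and> - x \<in> Rg \<alpha>))
     \<and> (\<forall>\<alpha> \<beta>. \<forall>x\<in>Rg \<alpha>. \<forall>y\<in>Rg \<beta>. x * y \<in> Rg (\<alpha> + \<beta>))
     \<and> (\<forall>x. \<exists>!c. finite {\<alpha>. c \<alpha> \<noteq> 0} \<and> (\<forall>\<alpha>. c \<alpha> \<in> Rg \<alpha>)
                  \<and> x = (\<Sum>\<alpha>\<in>{\<alpha>. c \<alpha> \<noteq> 0}. c \<alpha>))"

definition hcomp :: "('g::cancel_comm_monoid_add \<Rightarrow> ('a::idom) set) \<Rightarrow> 'a \<Rightarrow> 'g \<Rightarrow> 'a" where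
  "hcomp Rg x = (THE c. finite {\<alpha>. c \<alpha> \<noteq> 0} \<and> (\<forall>\<alpha>. c \<alpha> \<in> Rg \<alpha>)
                  \<and> x = (\<Sum>\<alpha>\<in>{\<alpha>. c \<alpha> \<noteq> 0}. c \<alpha>))"

definition content_ideal :: "('g::cancel_comm_monoid_add \<Rightarrow> ('a::idom) set) \<Rightarrow> 'a \<Rightarrow> 'a set" where
  "content_ideal Rg a = ideal_gen (range (hcomp Rg a))"

text \<open>A_f = sum of the C(f_i); the sum of ideals generated by sets is the ideal
  generated by the union of the sets.\<close>
definition A_ideal :: "('g::cancel_comm_monoid_add \<Rightarrow> ('a::idom) set) \<Rightarrow> 'a poly \<Rightarrow> 'a set" where
  "A_ideal Rg f = ideal_gen (\<Union>i\<le>degree f. range (hcomp Rg (coeff f i)))"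

text \<open>Homogeneous ideal: I = \<Oplus> (I \<inter> R_\<alpha>), i.e. all components of elements of I lie in I.\<close>
definition homogeneous_ideal :: "('g::cancel_comm_monoid_add \<Rightarrow> ('a::idom) set) \<Rightarrow> 'a set \<Rightarrow> bool" where
  "homogeneous_ideal Rg I \<longleftrightarrow> is_ideal I \<and> (\<forall>x\<in>I. \<forall>\<alpha>. hcomp Rg x \<alpha> \<in> I)"

definition graded_Pruefer :: "('g::cancel_comm_monoid_add \<Rightarrow> ('a::idom) set) \<Rightarrow> bool" where
  "graded_Pruefer Rg \<longleftrightarrow>
     (\<forall>I. homogeneous_ideal Rg I \<and> fin_gen_ideal I \<and> I \<noteq> {0} \<longrightarrow> invertible_ideal I)"

end

theory Submission
  imports Defs "HOL-Library.Poly_Mapping" "HOL-Library.Product_Plus"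
begin

text \<open>Write \<open>f\<close> as an element of the monoid ring of \<open>\<nat> \<times> \<Gamma>\<close>; its content is \<open>A_f\<close>. Since
  \<open>\<nat> \<times> \<Gamma>\<close> carries a total translation-invariant order, any two nonempty finite subsets have a
  unique product. If all finitely generated homogeneous ideals are cancellable, this yields
  Gauss's lemma \<open>A_f A_g = A_{fg}\<close> by induction on the number of bihomogeneous components.
  Conversely, multiplicativity inverts \<open>(a, b)\<close> for homogeneous \<open>a\<close>, \<open>b\<close>, and a partition of
  unity passes from two to finitely many generators.\<close>

section \<open>Ideals\<close>

text \<open>Merging X-degree and \<Gamma>-degree makes every coefficient homogeneous, and a unique
  product exposes one product a * b of coefficients as a coefficient of P * Q. Deleting a term from
  a factor changes the content of the product; cancelling the content of P, which is generated by
  homogeneous elements, repairs this. Fractions occur only in translating invertibility: an inverse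
  of I is recorded by a denominator d and elements c_i with d = \<Sum> a_i c_i, all a_i in I, and
  c_i I \<subseteq> d R. In the converse direction, local principality is expressed without
  localising, by an element e with e b / a and (1 - e) a / b in R; then e / a and (1 - e) / b
  generate the inverse of (a, b). This form can be glued over more than two generators.\<close>

lemma is_ideal_zero: "is_ideal I \<Longrightarrow> 0 \<in> I"
  and is_ideal_add: "is_ideal I \<Longrightarrow> x \<in> I \<Longrightarrow> y \<in> I \<Longrightarrow> x + y \<in> I"
  and is_ideal_mult: "is_ideal I \<Longrightarrow> x \<in> I \<Longrightarrow> r * x \<in> I"
  and is_ideal_mult_right: "is_ideal I \<Longrightarrow> x \<in> I \<Longrightarrow> x * r \<in> I"
  by (auto simp: is_ideal_def) (metis mult.commute)

lemma is_ideal_uminus: "is_ideal I \<Longrightarrow> x \<in> I \<Longrightarrow> - x \<in> I"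
  using is_ideal_mult[of I x "-1"] by simp

lemma is_ideal_diff: "is_ideal I \<Longrightarrow> x \<in> I \<Longrightarrow> y \<in> I \<Longrightarrow> x - y \<in> I"
  using is_ideal_add[of I x "- y"] is_ideal_uminus[of I y] by simp

lemma is_ideal_sum: "is_ideal I \<Longrightarrow> (\<And>s. s \<in> F \<Longrightarrow> g s \<in> I) \<Longrightarrow> sum g F \<in> I"
  by (induction F rule: infinite_finite_induct) (auto intro: is_ideal_zero is_ideal_add)

text \<open>Because these solution sets are ideals, a divisibility or a membership after
  multiplication need only be checked on generators, through \<open>ideal_gen_least\<close>.\<close>

lemma is_ideal_multiples: "is_ideal {x. d dvd x * c}"
  by (auto simp: is_ideal_def distrib_right mult.assoc)

lemma is_ideal_colon: "is_ideal I \<Longrightarrow> is_ideal {x. y * x \<in> I}"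
  unfolding is_ideal_def by (auto simp: distrib_left mult.left_commute)

lemma is_ideal_pair:
  assumes J: "is_ideal J"
  shows "is_ideal {a * u + b * v | u v. u \<in> J \<and> v \<in> J}" (is "is_ideal ?I")
  unfolding is_ideal_def
proof (intro conjI ballI allI)
  show "0 \<in> ?I" using is_ideal_zero[OF J] by (auto intro!: exI[of _ 0])
  fix x assume "x \<in> ?I"
  then obtain u v where x: "x = a * u + b * v" "u \<in> J" "v \<in> J" by blast
  show "r * x \<in> ?I" for r
  proof -
    have "r * x = a * (r * u) + b * (r * v)" by (simp add: x(1) algebra_simps)
    then show ?thesis using is_ideal_mult[OF J] x(2,3) by blast
  qed
  fix y assume "y \<in> ?I"
  then obtain u' v' where y: "y = a * u' + b * v'" "u' \<in> J" "v' \<in> J" by blast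
  have "x + y = a * (u + u') + b * (v + v')" by (simp add: x(1) y(1) algebra_simps)
  then show "x + y \<in> ?I" using is_ideal_add[OF J] x(2,3) y(2,3) by blast
qed

lemma is_ideal_ideal_gen: "is_ideal (ideal_gen S)"
  unfolding is_ideal_def
proof (intro conjI ballI allI)
  show "0 \<in> ideal_gen S"
    unfolding ideal_gen_def by (rule CollectI, rule exI[of _ "{}"]) simp
next
  fix x y assume "x \<in> ideal_gen S" "y \<in> ideal_gen S"
  then obtain F c G d where F: "finite F" "F \<subseteq> S" "x = (\<Sum>s\<in>F. c s * s)"
    and G: "finite G" "G \<subseteq> S" "y = (\<Sum>s\<in>G. d s * s)"
    unfolding ideal_gen_def by blast
  let ?c = "\<lambda>s. if s \<in> F then c s else 0" and ?d = "\<lambda>s. if s \<in> G then d s else 0"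
  have "x = (\<Sum>s\<in>F \<union> G. ?c s * s)"
    unfolding F(3) by (rule sum.mono_neutral_cong_left) (use F G in auto)
  moreover have "y = (\<Sum>s\<in>F \<union> G. ?d s * s)"
    unfolding G(3) by (rule sum.mono_neutral_cong_left) (use F G in auto)
  ultimately have "x + y = (\<Sum>s\<in>F \<union> G. (?c s + ?d s) * s)"
    by (simp only: sum.distrib[symmetric] distrib_right)
  moreover have "finite (F \<union> G)" "F \<union> G \<subseteq> S" using F G by auto
  ultimately show "x + y \<in> ideal_gen S"
    unfolding ideal_gen_def by (intro CollectI exI conjI) assumption+
next
  fix r x assume "x \<in> ideal_gen S"
  then obtain F c where F: "finite F" "F \<subseteq> S" "x = (\<Sum>s\<in>F. c s * s)"
    unfolding ideal_gen_def by blast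
  have "r * x = (\<Sum>s\<in>F. (r * c s) * s)"
    by (simp add: F(3) sum_distrib_left mult.assoc)
  then show "r * x \<in> ideal_gen S"
    unfolding ideal_gen_def using F(1,2) by (intro CollectI exI conjI) assumption+
qed

lemma ideal_gen_superset: "s \<in> S \<Longrightarrow> s \<in> ideal_gen S"
  unfolding ideal_gen_def by (rule CollectI, rule exI[of _ "{s}"], rule exI[of _ "\<lambda>_. 1"]) simp

lemma ideal_gen_least: "is_ideal I \<Longrightarrow> S \<subseteq> I \<Longrightarrow> ideal_gen S \<subseteq> I"
  unfolding ideal_gen_def by (auto intro!: is_ideal_sum is_ideal_mult)

lemma is_ideal_ideal_prod: "is_ideal (ideal_prod I J)"
  unfolding ideal_prod_def by (rule is_ideal_ideal_gen)

lemma ideal_prodI: "a \<in> I \<Longrightarrow> b \<in> J \<Longrightarrow> a * b \<in> ideal_prod I J"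
  unfolding ideal_prod_def by (rule ideal_gen_superset) blast

lemma ideal_prod_least:
  "is_ideal K \<Longrightarrow> (\<And>a b. a \<in> I \<Longrightarrow> b \<in> J \<Longrightarrow> a * b \<in> K) \<Longrightarrow> ideal_prod I J \<subseteq> K"
  unfolding ideal_prod_def by (rule ideal_gen_least) auto

text \<open>Two colon ideals, one for each factor, reduce the inclusion to products of
  generators.\<close>

lemma ideal_prod_gen_least:
  assumes K: "is_ideal K" and st: "\<And>s t. s \<in> S \<Longrightarrow> t \<in> T \<Longrightarrow> s * t \<in> K"
  shows "ideal_prod (ideal_gen S) (ideal_gen T) \<subseteq> K"
proof (rule ideal_prod_least[OF K])
  fix a b assume a: "a \<in> ideal_gen S" and b: "b \<in> ideal_gen T"
  have *: "s * b \<in> K" if "s \<in> S" for s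
    using ideal_gen_least[OF is_ideal_colon[OF K, of s], of T] st[OF that] b by blast
  then show "a * b \<in> K"
    using ideal_gen_least[OF is_ideal_colon[OF K, of b], of S] a by (auto simp: mult.commute)
qed

section \<open>Invertible ideals\<close>

lemma embR_mult: "embR (a * b) = embR a * embR b"
  and embR_add: "embR (a + b) = embR a + embR b"
  and embR_zero: "embR 0 = 0"
  and embR_one: "embR 1 = 1"
  and embR_eq_iff: "embR a = embR b \<longleftrightarrow> a = b"
  by (simp_all add: embR_def eq_fract Zero_fract_def One_fract_def)

lemma embR_sum: "embR (sum g F) = (\<Sum>i\<in>F. embR (g i))"
  by (induction F rule: infinite_finite_induct) (simp_all add: embR_zero embR_add)

text \<open>Clears denominators in 1 = \<Sum> a_i b_i: d is a common denominator of the inverse and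
  c_i = d b_i. The divisibility says that b_i maps I into R.\<close>

lemma invertible_idealE:
  assumes "invertible_ideal I"
  obtains F :: "nat set" and a c and d :: "'a::idom"
  where "d \<noteq> 0" "finite F" "\<forall>i\<in>F. a i \<in> I"
    "\<forall>i\<in>F. \<forall>y\<in>I. d dvd y * c i" "d = (\<Sum>i\<in>F. a i * c i)"
proof -
  from assms obtain J where J: "fractional_ideal J" and IJ: "frac_prod I J = range embR"
    unfolding invertible_ideal_def by blast
  from J obtain d where d: "d \<noteq> 0" "\<And>x. x \<in> J \<Longrightarrow> embR d * x \<in> range embR"
    unfolding fractional_ideal_def by blast
  have "embR 1 \<in> frac_prod I J" unfolding IJ by blast
  then obtain F :: "nat set" and a b where F: "finite F" "\<And>i. i \<in> F \<Longrightarrow> a i \<in> I"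
    "\<And>i. i \<in> F \<Longrightarrow> b i \<in> J" and one: "embR 1 = (\<Sum>i\<in>F. embR (a i) * b i)"
    unfolding frac_prod_def by blast
  have "\<forall>i\<in>F. \<exists>c. embR d * b i = embR c" using d(2) F(3) by blast
  then obtain c where c: "\<And>i. i \<in> F \<Longrightarrow> embR d * b i = embR (c i)" by metis
  have "embR d = embR d * embR 1" by (simp add: embR_one)
  also have "\<dots> = (\<Sum>i\<in>F. embR (a i) * (embR d * b i))"
    unfolding one by (simp add: sum_distrib_left mult.left_commute)
  also have "\<dots> = embR (\<Sum>i\<in>F. a i * c i)"
    by (simp add: c embR_sum embR_mult)
  finally have sum: "d = (\<Sum>i\<in>F. a i * c i)" by (simp only: embR_eq_iff)
  have dvd: "d dvd y * c i" if i: "i \<in> F" and y: "y \<in> I" for i y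
  proof -
    have "embR y * b i \<in> frac_prod I J"
      unfolding frac_prod_def
      by (rule CollectI, rule exI[of _ "{0}"], rule exI[of _ "\<lambda>_. y"], rule exI[of _ "\<lambda>_. b i"])
        (use F(3)[OF i] y in simp)
    then obtain r where r: "embR y * b i = embR r" unfolding IJ by blast
    have "embR (y * c i) = embR y * (embR d * b i)" by (simp add: embR_mult c[OF i])
    also have "\<dots> = embR (d * r)" by (simp add: embR_mult r[symmetric] mult.left_commute)
    finally show ?thesis by (simp add: embR_eq_iff)
  qed
  show thesis
    by (rule that[OF d(1) F(1) _ _ sum]) (simp_all add: F(2) dvd)
qed

lemma invertible_idealI:
  fixes d :: "'a::idom" and a c :: "'i \<Rightarrow> 'a"
  assumes I: "is_ideal I" and d: "d \<noteq> 0" and F: "finite F" "\<And>i. i \<in> F \<Longrightarrow> a i \<in> I"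
    and c: "\<And>i y. i \<in> F \<Longrightarrow> y \<in> I \<Longrightarrow> d dvd y * c i" and sum: "d = (\<Sum>i\<in>F. a i * c i)"
  shows "invertible_ideal I"
proof -
  \<comment> \<open>K consists of the numerators over d: z / d maps I into R exactly when d divides
    all y * z.\<close>
  define K where "K = {z. \<forall>y\<in>I. d dvd y * z}"
  define J where "J = (\<lambda>z. embR z / embR d) ` K"
  have K: "is_ideal K"
    unfolding K_def is_ideal_def by (auto simp: distrib_left mult.left_commute)
  have ed: "embR d \<noteq> 0" using d embR_eq_iff[of d 0] by (simp add: embR_zero)
  have "fractional_ideal J"
    unfolding fractional_ideal_def
  proof (intro conjI ballI allI)
    show "0 \<in> J" unfolding J_def using is_ideal_zero[OF K] by (force simp: embR_zero)
    fix x assume x: "x \<in> J"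
    show "x + y \<in> J" if "y \<in> J" for y
    proof -
      from x that obtain z w where "z \<in> K" "x = embR z / embR d" "w \<in> K" "y = embR w / embR d"
        unfolding J_def by blast
      then show ?thesis unfolding J_def
        by (intro image_eqI[of _ _ "z + w"]) (auto simp: embR_add add_divide_distrib is_ideal_add[OF K])
    qed
    show "embR r * x \<in> J" for r
    proof -
      from x obtain z where "z \<in> K" "x = embR z / embR d" unfolding J_def by blast
      then show ?thesis unfolding J_def
        by (intro image_eqI[of _ _ "r * z"]) (auto simp: embR_mult is_ideal_mult[OF K])
    qed
  next
    show "\<exists>d. d \<noteq> 0 \<and> (\<forall>x\<in>J. embR d * x \<in> range embR)"
      using d ed unfolding J_def by (intro exI[of _ d]) auto
  qed
  moreover have "frac_prod I J = range embR"
  proof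
    show "frac_prod I J \<subseteq> range embR"
    proof
      fix z assume "z \<in> frac_prod I J"
      then obtain G :: "nat set" and f b where G: "\<forall>i\<in>G. f i \<in> I \<and> b i \<in> J"
        and z: "z = (\<Sum>i\<in>G. embR (f i) * b i)" unfolding frac_prod_def by blast
      have "\<exists>r. embR (f i) * b i = embR r" if "i \<in> G" for i
      proof -
        from G that obtain w where w: "w \<in> K" "b i = embR w / embR d" and "f i \<in> I"
          unfolding J_def by blast
        then obtain r where "f i * w = d * r" unfolding K_def by (auto elim: dvdE)
        then have "embR (f i) * embR w = embR d * embR r" by (metis embR_mult)
        then have "embR (f i) * b i = embR r" unfolding w(2) using ed by (simp add: field_simps)
        then show ?thesis ..
      qed
      then obtain r where "\<And>i. i \<in> G \<Longrightarrow> embR (f i) * b i = embR (r i)" by metis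
      then have "z = embR (\<Sum>i\<in>G. r i)" unfolding z by (simp add: embR_sum)
      then show "z \<in> range embR" by blast
    qed
    \<comment> \<open>\<open>frac_prod\<close> sums over sets of natural numbers, whereas F may have
      any index type, so F is enumerated.\<close>
    obtain h where h: "bij_betw h {0..<card F} F"
      using ex_bij_betw_nat_finite[OF F(1)] by blast
    show "range embR \<subseteq> frac_prod I J"
    proof
      fix z :: "'a fract" assume "z \<in> range embR"
      then obtain r where r: "z = embR r" by blast
      have "embR r * embR d = (\<Sum>i\<in>F. embR (r * a i) * embR (c i))"
        by (subst sum) (simp add: embR_sum embR_mult sum_distrib_left mult.assoc)
      then have "z = (\<Sum>i\<in>F. embR (r * a i) * (embR (c i) / embR d))"
        unfolding r using ed by (simp add: sum_divide_distrib[symmetric] field_simps)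
      also have "\<dots> = (\<Sum>n\<in>{0..<card F}. embR (r * a (h n)) * (embR (c (h n)) / embR d))"
        by (rule sum.reindex_bij_betw[OF h, symmetric])
      finally have z: "z = (\<Sum>n\<in>{0..<card F}. embR (r * a (h n)) * (embR (c (h n)) / embR d))" .
      have hF: "h n \<in> F" if "n \<in> {0..<card F}" for n
        using h that by (auto simp: bij_betw_def)
      show "z \<in> frac_prod I J"
        unfolding frac_prod_def
        by (rule CollectI, rule exI[of _ "{0..<card F}"], rule exI[of _ "\<lambda>n. r * a (h n)"],
            rule exI[of _ "\<lambda>n. embR (c (h n)) / embR d"])
          (use z hF F(2) c in \<open>auto simp: J_def K_def intro!: is_ideal_mult[OF I]\<close>)
    qed
  qed
  ultimately show ?thesis unfolding invertible_ideal_def by blast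
qed

text \<open>From x I \<subseteq> I K, multiplication by the inverse of I gives x \<in> K. With
  cleared denominators: (I K) c_i \<subseteq> d K, so each x a_i c_i lies in d K, and these sum to d
  x.\<close>

lemma invertible_ideal_cancel:
  fixes x :: "'a::idom"
  assumes I: "invertible_ideal I" and K: "is_ideal K"
    and x: "\<And>i. i \<in> I \<Longrightarrow> x * i \<in> ideal_prod I K"
  shows "x \<in> K"
proof -
  from I obtain F :: "nat set" and a c d where d: "d \<noteq> 0" and "finite F"
    and a: "\<forall>i\<in>F. a i \<in> I"
    and c: "\<forall>i\<in>F. \<forall>y\<in>I. d dvd y * c i" and sum: "d = (\<Sum>i\<in>F. a i * c i)"
    by (rule invertible_idealE)
  have "\<exists>k\<in>K. y * c i = d * k" if i: "i \<in> F" and y: "y \<in> ideal_prod I K" for i y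
  proof -
    let ?L = "{y. \<exists>k\<in>K. y * c i = d * k}"
    have "is_ideal ?L"
      unfolding is_ideal_def
    proof (intro conjI ballI allI)
      show "0 \<in> ?L" using is_ideal_zero[OF K] by (auto intro!: bexI[of _ 0])
      fix u assume "u \<in> ?L"
      then obtain k where k: "k \<in> K" "u * c i = d * k" by blast
      show "r * u \<in> ?L" for r
        using is_ideal_mult[OF K k(1), of r] k(2) by (auto intro!: bexI[of _ "r * k"] simp: mult_ac)
      fix v assume "v \<in> ?L"
      then obtain l where l: "l \<in> K" "v * c i = d * l" by blast
      show "u + v \<in> ?L"
        using is_ideal_add[OF K k(1) l(1)] k(2) l(2)
        by (auto intro!: bexI[of _ "k + l"] simp: distrib_left distrib_right)
    qed
    moreover have "s * k \<in> ?L" if s: "s \<in> I" and k: "k \<in> K" for s k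
    proof -
      obtain q where "s * c i = d * q" using c i s unfolding dvd_def by blast
      then have "s * k * c i = d * (q * k)" by (metis mult.assoc mult.commute)
      then show ?thesis using is_ideal_mult[OF K k] by blast
    qed
    ultimately have "ideal_prod I K \<subseteq> ?L" by (rule ideal_prod_least)
    then show ?thesis using y by blast
  qed
  then have "\<forall>i\<in>F. \<exists>k\<in>K. x * a i * c i = d * k" using x a by blast
  then obtain k where k: "\<And>i. i \<in> F \<Longrightarrow> k i \<in> K" "\<And>i. i \<in> F \<Longrightarrow> x * a i * c i = d * k i"
    by metis
  have "d * x = (\<Sum>i\<in>F. x * a i * c i)"
    by (subst sum) (simp add: sum_distrib_left sum_distrib_right mult_ac)
  also have "\<dots> = d * (\<Sum>i\<in>F. k i)" by (simp add: k(2) sum_distrib_left)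
  finally have "x = (\<Sum>i\<in>F. k i)" using d by simp
  then show ?thesis using is_ideal_sum[OF K k(1)] by simp
qed

text \<open>The elements \<open>x s\<close> play the role of a partition of unity subordinate to the open sets
  where \<open>s\<close> generates the ideal.\<close>

lemma partition_of_unity_if_pairwise:
  fixes S :: "'a::comm_ring_1 set"
  assumes "finite S" "S \<noteq> {}"
    and "\<And>a b. a \<in> S \<Longrightarrow> b \<in> S \<Longrightarrow> \<exists>e. a dvd e * b \<and> b dvd (1 - e) * a"
  shows "\<exists>x. (\<Sum>s\<in>S. x s) = 1 \<and> (\<forall>s\<in>S. \<forall>t\<in>S. s dvd x s * t)"
  using assms
proof (induction S rule: finite_ne_induct)
  case (singleton a)
  show ?case by (rule exI[of _ "\<lambda>_. 1"]) simp
next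
  case (insert b S)
  then obtain x where x: "(\<Sum>s\<in>S. x s) = 1" "\<And>s t. s \<in> S \<Longrightarrow> t \<in> S \<Longrightarrow> s dvd x s * t"
    by (metis insertI2)
  obtain e where e: "\<And>s. s \<in> S \<Longrightarrow> s dvd e s * b" "\<And>s. s \<in> S \<Longrightarrow> b dvd (1 - e s) * s"
  proof -
    have "\<forall>s\<in>S. \<exists>e. s dvd e * b \<and> b dvd (1 - e) * s" using insert.prems by blast
    then show thesis using that by metis
  qed
  \<comment> \<open>The weight x_s is split between s and the new element b: the share e_s stays at
    s, the share 1 - e_s moves to b, so the total remains 1.\<close>
  let ?xb = "\<Sum>s\<in>S. x s * (1 - e s)"
  let ?y = "\<lambda>s. if s = b then ?xb else x s * e s"
  have "(\<Sum>s\<in>insert b S. ?y s) = ?xb + (\<Sum>s\<in>S. x s * e s)"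
    using insert.hyps by (simp add: sum.insert) (rule sum.cong, auto)
  also have "\<dots> = (\<Sum>s\<in>S. x s)" by (simp add: sum.distrib[symmetric] algebra_simps)
  finally have "(\<Sum>s\<in>insert b S. ?y s) = 1" by (simp add: x(1))
  moreover have "s dvd ?y s * t" if s: "s \<in> insert b S" and t: "t \<in> insert b S" for s t
  proof (cases "s = b")
    case True
    \<comment> \<open>For t in S the old partition turns x_{s'} t into a multiple of s', and b
      divides (1 - e_{s'}) s'.\<close>
    have "b dvd x s' * (1 - e s') * t" if s': "s' \<in> S" for s'
    proof (cases "t = b")
      case False
      then obtain q where "x s' * t = s' * q" using x(2)[OF s'] t by (auto elim: dvdE)
      then have "x s' * (1 - e s') * t = (1 - e s') * s' * q" by (metis mult.assoc mult.commute)
      then show ?thesis using e(2)[OF s'] by simp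
    qed simp
    then show ?thesis using True by (simp add: sum_distrib_right dvd_sum)
  next
    case False
    then have sS: "s \<in> S" using s by simp
    show ?thesis
    proof (cases "t = b")
      case True
      then have "s dvd x s * (e s * t)" using e(1)[OF sS] by simp
      then show ?thesis using False by (simp add: mult.assoc)
    next
      case False
      then have "s dvd e s * (x s * t)" using x(2)[OF sS] t by simp
      then show ?thesis using \<open>s \<noteq> b\<close> by (simp add: mult_ac)
    qed
  qed
  ultimately show ?case by blast
qed

text \<open>The inverse is generated by the fractions x_s / s: they map every generator t into R,
  and \<Sum> s (x_s / s) = 1. The common denominator is the product of all generators, so c_s / d =
  x_s / s.\<close>

lemma invertible_ideal_gen:
  fixes S :: "'a::idom set"
  assumes S: "finite S" "S \<noteq> {}" "0 \<notin> S"
    and pair: "\<And>a b. a \<in> S \<Longrightarrow> b \<in> S \<Longrightarrow> \<exists>e. a dvd e * b \<and> b dvd (1 - e) * a"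
  shows "invertible_ideal (ideal_gen S)"
proof -
  obtain x where x: "(\<Sum>s\<in>S. x s) = 1" "\<And>s t. s \<in> S \<Longrightarrow> t \<in> S \<Longrightarrow> s dvd x s * t"
    using partition_of_unity_if_pairwise[OF S(1,2) pair] by blast
  define d where "d = \<Prod>S"
  define c where "c s = x s * \<Prod>(S - {s})" for s
  have d: "d = s * \<Prod>(S - {s})" if "s \<in> S" for s
    unfolding d_def by (rule prod.remove[OF S(1) that])
  show ?thesis
  proof (rule invertible_idealI[OF is_ideal_ideal_gen, of d S "\<lambda>s. s" S c])
    show "d \<noteq> 0" unfolding d_def using S(1,3) by simp
    have "(\<Sum>s\<in>S. s * c s) = (\<Sum>s\<in>S. x s * d)"
      by (rule sum.cong) (simp_all add: c_def d mult.left_commute)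
    then show "d = (\<Sum>s\<in>S. s * c s)" by (simp add: sum_distrib_right[symmetric] x(1))
    fix s y assume s: "s \<in> S" and y: "y \<in> ideal_gen S"
    have "d dvd t * c s" if "t \<in> S" for t
      using mult_dvd_mono[OF x(2)[OF s that] dvd_refl[of "\<Prod>(S - {s})"]]
      unfolding d[OF s] c_def by (simp add: mult_ac)
    then show "d dvd y * c s"
      using ideal_gen_least[OF is_ideal_multiples, of S d "c s"] y by blast
  qed (use S in \<open>auto intro: ideal_gen_superset\<close>)
qed

section \<open>Unique products in torsion-free monoids\<close>

lemma nsum_of_0: "nsum_of 0 a = 0"
  and nsum_of_Suc: "nsum_of (Suc n) a = nsum_of n a + a"
  and nsum_of_add_left: "nsum_of (m + n) a = nsum_of m a + nsum_of n a"
  by (simp_all add: nsum_of_def) (induction n, simp_all add: ac_simps)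

lemma nsum_of_mult: "nsum_of (m * n) a = nsum_of m (nsum_of n a)"
  by (induction m) (simp_all add: nsum_of_0 nsum_of_Suc nsum_of_add_left add.commute)

lemma nsum_of_Pair: "nsum_of n (a, b) = (nsum_of n a, nsum_of n b)"
  by (induction n) (simp_all add: nsum_of_0 nsum_of_Suc zero_prod_def)

text \<open>Partial strict orders, so that Zorn's lemma can start from the empty relation; the
  equivalence also gives cancellation of summands, which replaces subtraction.\<close>

definition invariant_order :: "('m::cancel_comm_monoid_add \<times> 'm) set \<Rightarrow> bool" where
  "invariant_order r \<longleftrightarrow> irrefl r \<and> trans r \<and> (\<forall>a b c. (a + c, b + c) \<in> r \<longleftrightarrow> (a, b) \<in> r)"

lemma invariant_order_nsum_of:
  assumes r: "invariant_order r" and ab: "(a, b) \<in> r" and n: "n > 0"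
  shows "(nsum_of n a, nsum_of n b) \<in> r"
  using n
proof (induction n rule: nat_induct_non_zero)
  case 1
  show ?case using ab by (simp add: nsum_of_def)
next
  case (Suc n)
  have "(nsum_of n a + a, nsum_of n b + a) \<in> r"
    using r Suc.IH unfolding invariant_order_def by blast
  moreover have "(nsum_of n b + a, nsum_of n b + b) \<in> r"
    using r ab add.commute[of "nsum_of n b"] unfolding invariant_order_def by simp
  ultimately show ?case
    using r unfolding invariant_order_def nsum_of_Suc by (blast dest: transD)
qed

text \<open>The only obstruction to forcing a < b is that r already has n b < n a for some n > 0. In
  the new relation n = 0 recovers r, and n = 1 yields a < b.\<close>

lemma invariant_order_extend:
  fixes a b :: "'m::cancel_comm_monoid_add"
  assumes tf: "torsionfree_quotient TYPE('m)" and r: "invariant_order r" and "a \<noteq> b"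
    and no: "\<And>n. n > 0 \<Longrightarrow> (nsum_of n b, nsum_of n a) \<notin> r"
  shows "\<exists>r'. invariant_order r' \<and> r \<subseteq> r' \<and> (a, b) \<in> r'"
proof -
  have irr: "(x, x) \<notin> r" and tr: "(x, y) \<in> r \<Longrightarrow> (y, z) \<in> r \<Longrightarrow> (x, z) \<in> r"
    and inv: "(x + c, y + c) \<in> r \<longleftrightarrow> (x, y) \<in> r" for x y z c
    using r unfolding invariant_order_def irrefl_def trans_def by blast+
  have tr': "(x, y) \<in> r\<^sup>= \<Longrightarrow> (y, z) \<in> r\<^sup>= \<Longrightarrow> (x, z) \<in> r\<^sup>=" for x y z using tr by auto
  have inv': "(x + c, y + c) \<in> r\<^sup>= \<longleftrightarrow> (x, y) \<in> r\<^sup>=" for x y c using inv by auto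
  \<comment> \<open>\<open>x < y\<close> iff \<open>y - x \<ge> n (b - a)\<close> for some \<open>n\<close>, written without subtraction.\<close>
  define r' where
    "r' = {(x, y). x \<noteq> y \<and> (\<exists>n. (x + nsum_of n b, y + nsum_of n a) \<in> r\<^sup>=)}"
  have trans': "\<exists>n. (x + nsum_of n b, z + nsum_of n a) \<in> r\<^sup>= \<and> x \<noteq> z"
    if "(x, y) \<in> r'" "(y, z) \<in> r'" for x y z
  proof -
    from that obtain n m where n: "(x + nsum_of n b, y + nsum_of n a) \<in> r\<^sup>=" "x \<noteq> y"
      and m: "(y + nsum_of m b, z + nsum_of m a) \<in> r\<^sup>=" unfolding r'_def by blast
    have "(x + nsum_of n b + nsum_of m b, y + nsum_of n a + nsum_of m b) \<in> r\<^sup>="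
      using n inv' by blast
    moreover have "(y + nsum_of m b + nsum_of n a, z + nsum_of m a + nsum_of n a) \<in> r\<^sup>="
      using m inv' by blast
    ultimately have *: "(x + nsum_of (n + m) b, z + nsum_of (n + m) a) \<in> r\<^sup>="
      using tr' unfolding nsum_of_add_left by (simp add: ac_simps)
    have "x \<noteq> z"
    proof
      assume "x = z"
      then have nm: "(nsum_of (n + m) b, nsum_of (n + m) a) \<in> r\<^sup>="
        using * inv'[of "nsum_of (n + m) b" x "nsum_of (n + m) a"]
        unfolding add.commute[of _ x] by blast
      \<comment> \<open>For N = n + m > 0 the relation N b \<le> N a is impossible: strictness is
        excluded by \<open>no\<close>, equality by torsion-freeness. With n = m = 0 the cycle would
        already lie in r.\<close>
      have "n + m = 0"
      proof (rule ccontr)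
        assume "n + m \<noteq> 0"
        then have "nsum_of (n + m) b = nsum_of (n + m) a" using nm no[of "n + m"] by auto
        then show False
          using tf \<open>n + m \<noteq> 0\<close> \<open>a \<noteq> b\<close> unfolding torsionfree_quotient_def by (metis gr0I)
      qed
      then have "(x, y) \<in> r\<^sup>=" "(y, x) \<in> r\<^sup>="
        using n m \<open>x = z\<close> by (auto simp: nsum_of_0)
      then show False using n(2) irr tr by blast
    qed
    then show ?thesis using * by blast
  qed
  have inv_r': "(x + c, y + c) \<in> r' \<longleftrightarrow> (x, y) \<in> r'" for x y c
  proof -
    have "(x + c + nsum_of n b, y + c + nsum_of n a) \<in> r\<^sup>= \<longleftrightarrow>
        (x + nsum_of n b, y + nsum_of n a) \<in> r\<^sup>=" for n
      using inv'[of "x + nsum_of n b" c "y + nsum_of n a"] by (simp add: ac_simps)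
    then show ?thesis unfolding r'_def by simp
  qed
  have "irrefl r'" unfolding irrefl_def r'_def by simp
  moreover have "trans r'"
    by (rule transI) (use trans' in \<open>unfold r'_def, blast\<close>)
  moreover have "r \<subseteq> r'"
  proof
    fix p assume "p \<in> r"
    moreover obtain x y where "p = (x, y)" by (cases p)
    ultimately show "p \<in> r'" unfolding r'_def using irr by (auto intro!: exI[of _ 0] simp: nsum_of_0)
  qed
  moreover have "(a, b) \<in> r'"
    unfolding r'_def using \<open>a \<noteq> b\<close>
    by (auto intro!: exI[of _ "Suc 0"] simp: nsum_of_def add.commute)
  ultimately show ?thesis unfolding invariant_order_def using inv_r' by blast
qed

lemma invariant_total_order_exists:
  assumes tf: "torsionfree_quotient TYPE('m::cancel_comm_monoid_add)"
  shows "\<exists>r :: ('m \<times> 'm) set. invariant_order r \<and> total r"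
proof -
  have "\<exists>r\<in>Collect invariant_order. \<forall>s\<in>Collect invariant_order. (r :: ('m \<times> 'm) set) \<subseteq> s \<longrightarrow> s = r"
  proof (rule subset_Zorn_nonempty)
    show "Collect invariant_order \<noteq> ({} :: ('m \<times> 'm) set set)"
      by (auto simp: invariant_order_def irrefl_def intro!: exI[of _ "{}"])
    fix C :: "('m \<times> 'm) set set"
    assume "C \<noteq> {}" and C: "subset.chain (Collect invariant_order) C"
    then have inv: "\<And>r. r \<in> C \<Longrightarrow> invariant_order r"
      and ch: "\<And>r s. r \<in> C \<Longrightarrow> s \<in> C \<Longrightarrow> r \<subseteq> s \<or> s \<subseteq> r"
      by (auto simp: subset_chain_def)
    have "trans (\<Union>C)"
    proof (rule transI)
      fix x y z assume "(x, y) \<in> \<Union>C" "(y, z) \<in> \<Union>C"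
      then obtain r s where rs: "r \<in> C" "(x, y) \<in> r" "s \<in> C" "(y, z) \<in> s" by blast
      then obtain t where "t \<in> C" "(x, y) \<in> t" "(y, z) \<in> t" using ch[of r s] by blast
      then show "(x, z) \<in> \<Union>C"
        using inv[of t] unfolding invariant_order_def trans_def by blast
    qed
    moreover have "irrefl (\<Union>C)"
      using inv unfolding invariant_order_def irrefl_def by blast
    moreover have "(a + c, b + c) \<in> \<Union>C \<longleftrightarrow> (a, b) \<in> \<Union>C" for a b c
      using inv unfolding invariant_order_def by blast
    ultimately show "\<Union>C \<in> Collect invariant_order"
      unfolding invariant_order_def by blast
  qed
  then obtain r :: "('m \<times> 'm) set" where r: "invariant_order r"
    and max: "\<And>s. invariant_order s \<Longrightarrow> r \<subseteq> s \<Longrightarrow> s = r" by blast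
  \<comment> \<open>Contraposition of the extension lemma at a maximal order: a missing relation a <
    b is explained by some n b < n a.\<close>
  have *: "\<exists>n>0. (nsum_of n b, nsum_of n a) \<in> r" if "a \<noteq> b" "(a, b) \<notin> r" for a b
    using invariant_order_extend[OF tf r that(1)] max that(2) by blast
  have "(a, b) \<in> r \<or> (b, a) \<in> r" if ab: "a \<noteq> b" for a b
  proof (rule ccontr)
    assume "\<not> ?thesis"
    then have "(a, b) \<notin> r" "(b, a) \<notin> r" by simp_all
    then obtain n m where n: "n > 0" "(nsum_of n b, nsum_of n a) \<in> r"
      and m: "m > 0" "(nsum_of m a, nsum_of m b) \<in> r"
      using *[OF ab] *[OF ab[symmetric]] by metis
    \<comment> \<open>Both obstructions are scaled to the common multiple m n, where they contradict
      each other.\<close>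
    have "(nsum_of (m * n) b, nsum_of (m * n) a) \<in> r"
      unfolding nsum_of_mult by (rule invariant_order_nsum_of[OF r n(2) m(1)])
    moreover have "(nsum_of (m * n) a, nsum_of (m * n) b) \<in> r"
      unfolding mult.commute[of m n] nsum_of_mult by (rule invariant_order_nsum_of[OF r m(2) n(1)])
    ultimately show False
      using r unfolding invariant_order_def irrefl_def trans_def by blast
  qed
  then show ?thesis using r unfolding total_on_def by blast
qed

text \<open>Take the maxima of A and B in a total invariant order: a smaller summand makes the sum
  strictly smaller.\<close>

lemma unique_product:
  fixes A B :: "'m::cancel_comm_monoid_add set"
  assumes tf: "torsionfree_quotient TYPE('m)"
    and A: "finite A" "A \<noteq> {}" and B: "finite B" "B \<noteq> {}"
  shows "\<exists>a\<in>A. \<exists>b\<in>B. \<forall>a'\<in>A. \<forall>b'\<in>B. a' + b' = a + b \<longrightarrow> a' = a \<and> b' = b"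
proof -
  obtain r :: "('m \<times> 'm) set" where r: "invariant_order r" and tot: "total r"
    using invariant_total_order_exists[OF tf] by blast
  have irr: "(x, x) \<notin> r" and tr: "(x, y) \<in> r \<Longrightarrow> (y, z) \<in> r \<Longrightarrow> (x, z) \<in> r"
    and inv: "(x + c, y + c) \<in> r \<longleftrightarrow> (x, y) \<in> r" for x y z c
    using r unfolding invariant_order_def irrefl_def trans_def by blast+
  have max: "\<exists>a\<in>A. \<forall>a'\<in>A. (a', a) \<in> r\<^sup>=" if "finite A" "A \<noteq> {}" for A
    using that
  proof (induction A rule: finite_ne_induct)
    case (insert x A)
    then obtain a where a: "a \<in> A" "\<And>a'. a' \<in> A \<Longrightarrow> (a', a) \<in> r\<^sup>=" by blast
    show ?case
    proof (cases "(x, a) \<in> r\<^sup>=")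
      case True
      then show ?thesis using a by blast
    next
      case False
      then have "(a, x) \<in> r" using tot unfolding total_on_def by blast
      then have "(a', x) \<in> r\<^sup>=" if "a' \<in> A" for a' using a(2)[OF that] tr by blast
      then show ?thesis by blast
    qed
  qed simp
  obtain a b where a: "a \<in> A" "\<And>a'. a' \<in> A \<Longrightarrow> (a', a) \<in> r\<^sup>="
    and b: "b \<in> B" "\<And>b'. b' \<in> B \<Longrightarrow> (b', b) \<in> r\<^sup>=" using max[OF A] max[OF B] by blast
  have "a' = a \<and> b' = b" if "a' \<in> A" "b' \<in> B" "a' + b' = a + b" for a' b'
  proof -
    have "b' = b"
    proof (rule ccontr)
      assume "b' \<noteq> b"
      then have "(a' + b', a' + b) \<in> r" using b(2)[OF that(2)] inv[of b' a' b] by (simp add: add.commute)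
      moreover have "(a' + b, a + b) \<in> r\<^sup>=" using a(2)[OF that(1)] inv[of a' b a] by auto
      ultimately show False using that(3) irr tr by (metis UnE pair_in_Id_conv)
    qed
    then show ?thesis using that(3) by simp
  qed
  then show ?thesis using a(1) b(1) by blast
qed

section \<open>Contents in monoid rings\<close>

abbreviation lookup :: "('m \<Rightarrow>\<^sub>0 'a::zero) \<Rightarrow> 'm \<Rightarrow> 'a" where
  "lookup \<equiv> Poly_Mapping.lookup"

abbreviation keys :: "('m \<Rightarrow>\<^sub>0 'a::zero) \<Rightarrow> 'm set" where
  "keys \<equiv> Poly_Mapping.keys"

lemma lookup_mult_sum:
  fixes P Q :: "'m::monoid_add \<Rightarrow>\<^sub>0 'a::semiring_0"
  shows "lookup (P * Q) k =
    (\<Sum>p\<in>keys P. \<Sum>q\<in>keys Q. lookup P p * lookup Q q when k = p + q)"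
proof -
  have inner: "(\<Sum>q. lookup Q q when k = l + q) = (\<Sum>q\<in>keys Q. lookup Q q when k = l + q)" for l
    by (rule Sum_any.expand_superset) (auto simp: in_keys_iff)
  have "lookup (P * Q) k = (\<Sum>l\<in>keys P. lookup P l * (\<Sum>q. lookup Q q when k = l + q))"
    unfolding lookup_mult by (rule Sum_any.expand_superset) (auto simp: in_keys_iff)
  then show ?thesis by (simp add: inner sum_distrib_left mult_when)
qed

text \<open>Only additive closure is required and the constraint k = p + q is kept, so that I may be
  an ideal or a single component \<open>Rg \<alpha>\<close>.\<close>

lemma lookup_mult_in:
  fixes P Q :: "'m::monoid_add \<Rightarrow>\<^sub>0 'a::semiring_0"
  assumes "0 \<in> I" and add: "\<And>x y. x \<in> I \<Longrightarrow> y \<in> I \<Longrightarrow> x + y \<in> I"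
    and prod: "\<And>p q. k = p + q \<Longrightarrow> lookup P p * lookup Q q \<in> I"
  shows "lookup (P * Q) k \<in> I"
proof -
  have sum: "sum g F \<in> I" if "\<And>s. s \<in> F \<Longrightarrow> g s \<in> I" for g and F :: "'m set"
    using that by (induction F rule: infinite_finite_induct) (auto intro: assms)
  show ?thesis
    unfolding lookup_mult_sum by (intro sum) (auto simp: when_def intro: assms)
qed

lemma lookup_mult_in_ideal:
  fixes P Q :: "'m::monoid_add \<Rightarrow>\<^sub>0 'a::comm_ring_1"
  assumes "is_ideal I" "\<And>p q. lookup P p * lookup Q q \<in> I"
  shows "lookup (P * Q) k \<in> I"
  by (rule lookup_mult_in) (use assms in \<open>auto intro: is_ideal_zero is_ideal_add\<close>)

lemma lookup_mult_unique:
  fixes P Q :: "'m::monoid_add \<Rightarrow>\<^sub>0 'a::semiring_0"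
  assumes p: "p \<in> keys P" and q: "q \<in> keys Q"
    and uniq: "\<forall>p'\<in>keys P. \<forall>q'\<in>keys Q. p' + q' = p + q \<longrightarrow> p' = p \<and> q' = q"
  shows "lookup (P * Q) (p + q) = lookup P p * lookup Q q"
proof -
  have "lookup (P * Q) (p + q) = (\<Sum>p'\<in>keys P. \<Sum>q'\<in>keys Q.
      if p' = p \<and> q' = q then lookup P p * lookup Q q else 0)"
    unfolding lookup_mult_sum by (intro sum.cong refl) (use uniq in \<open>auto simp: when_def\<close>)
  also have "\<dots> = (\<Sum>p'\<in>keys P. if p' = p then lookup P p * lookup Q q else 0)"
    by (intro sum.cong refl) (use q in auto)
  also have "\<dots> = lookup P p * lookup Q q" using p by simp
  finally show ?thesis .
qed

text \<open>Let \<open>a = P p0\<close> and \<open>b = Q q0\<close> be coefficients whose product \<open>a * b\<close> is a coefficient of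
  \<open>P * Q\<close>, and let \<open>I\<close> be the content of \<open>P * Q\<close>. Induction for \<open>P\<close> and \<open>Q - b\<close> gives
  \<open>a C(P) C(Q) \<subseteq> C(P) I\<close>, whence \<open>a C(Q) \<subseteq> I\<close> by cancellation; then induction for \<open>P - a\<close> and
  \<open>Q\<close> finishes the proof.\<close>

lemma content_mult_if_cancellative:
  fixes P Q :: "'m::cancel_comm_monoid_add \<Rightarrow>\<^sub>0 'a::idom"
  assumes tf: "torsionfree_quotient TYPE('m)"
    and cancel: "\<And>S K x. finite S \<Longrightarrow> S \<noteq> {} \<Longrightarrow> S \<subseteq> H - {0} \<Longrightarrow> is_ideal K \<Longrightarrow>
      (\<And>s. s \<in> S \<Longrightarrow> x * s \<in> ideal_prod (ideal_gen S) K) \<Longrightarrow> x \<in> K"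
    and "lookup P ` keys P \<subseteq> H"
  shows "lookup P p * lookup Q q \<in> ideal_gen (range (lookup (P * Q)))"
  using \<open>lookup P ` keys P \<subseteq> H\<close>
proof (induction "card (keys P) + card (keys Q)" arbitrary: P Q p q rule: less_induct)
  case less
  let ?I = "ideal_gen (range (lookup (P * Q)))"
  have I: "is_ideal ?I" by (rule is_ideal_ideal_gen)
  have coeff_I: "lookup (P * Q) k \<in> ?I" for k by (rule ideal_gen_superset) simp
  show ?case
  proof (cases "keys P = {} \<or> keys Q = {}")
    case True
    then show ?thesis using is_ideal_zero[OF I] by auto
  next
    case False
    then obtain p0 q0 where p0: "p0 \<in> keys P" and q0: "q0 \<in> keys Q"
      and uniq: "\<forall>p'\<in>keys P. \<forall>q'\<in>keys Q. p' + q' = p0 + q0 \<longrightarrow> p' = p0 \<and> q' = q0"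
      using unique_product[OF tf, of "keys P" "keys Q"] by auto
    define a b where "a = lookup P p0" and "b = lookup Q q0"
    have ab: "a * b \<in> ?I"
      using coeff_I[of "p0 + q0"] lookup_mult_unique[OF p0 q0 uniq] by (simp add: a_def b_def)
    define P' Q' where "P' = P - Poly_Mapping.single p0 a" and "Q' = Q - Poly_Mapping.single q0 b"
    have lookup_P': "lookup P' p = (if p = p0 then 0 else lookup P p)"
      and lookup_Q': "lookup Q' p = (if p = q0 then 0 else lookup Q p)" for p
      by (auto simp: P'_def Q'_def a_def b_def lookup_minus lookup_single)
    have keys_minus: "keys P' = keys P - {p0}" "keys Q' = keys Q - {q0}"
      by (auto simp: in_keys_iff lookup_P' lookup_Q' split: if_splits)
    have lessP: "card (keys P') + card (keys Q) < card (keys P) + card (keys Q)"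
      and lessQ: "card (keys P) + card (keys Q') < card (keys P) + card (keys Q)"
      unfolding keys_minus using p0 q0 card_Diff1_less[of "keys P" p0] card_Diff1_less[of "keys Q" q0] by simp_all

    let ?S = "lookup P ` keys P"
    let ?CI = "ideal_prod (ideal_gen ?S) ?I"
    have CI: "is_ideal ?CI" by (rule is_ideal_ideal_prod)
    have P_gen: "lookup P p \<in> ideal_gen ?S" for p
      using is_ideal_zero[OF is_ideal_ideal_gen] by (cases "p \<in> keys P") (auto simp: in_keys_iff intro: ideal_gen_superset)
    let ?K = "{x. a * x \<in> ?CI}"
    have K: "is_ideal ?K" by (rule is_ideal_colon[OF CI])
    \<comment> \<open>Since a * b lies in I, a * (P p * b) = P p * (a * b) lies in C(P) I. Together
      with a C(P * Q) \<subseteq> C(P) I, this shows that deleting b from Q keeps the coefficients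
      of the product in \<open>?K\<close>.\<close>
    have bP: "lookup P p * b \<in> ?K" for p
      using ideal_prodI[OF P_gen[of p] ab] by (simp add: mult_ac)
    have "lookup (P * Q') k \<in> ?K" for k
    proof -
      have "P * Q' = P * Q - P * Poly_Mapping.single q0 b" by (simp add: Q'_def algebra_simps)
      moreover have "lookup (P * Q) k \<in> ?K"
        using ideal_prodI[OF P_gen[of p0] coeff_I[of k]] by (simp add: a_def)
      moreover have "lookup (P * Poly_Mapping.single q0 b) k \<in> ?K"
        by (rule lookup_mult_in_ideal[OF K])
          (use bP is_ideal_zero[OF K] in \<open>auto simp: lookup_single when_def\<close>)
      ultimately show ?thesis using is_ideal_diff[OF K] by (simp only: lookup_minus)
    qed
    then have "ideal_gen (range (lookup (P * Q'))) \<subseteq> ?K"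
      by (intro ideal_gen_least[OF K]) blast
    then have PQ': "lookup P p * lookup Q' q \<in> ?K" for p q
      using less.hyps[OF lessQ less.prems] by blast
    have PQ: "lookup P p * lookup Q q \<in> ?K" for p q
      using PQ'[of p q] bP[of p] by (cases "q = q0") (simp_all add: lookup_Q' b_def)
    have aQ: "a * lookup Q q \<in> ?I" for q
    \<comment> \<open>Cancellation always concerns the content of the first factor, hence the
      condition on coefficients in \<open>H\<close> for P alone; it passes to P with a term
      deleted.\<close>
    proof (rule cancel[of ?S])
      show "?S \<subseteq> H - {0}" using less.prems by (auto simp: in_keys_iff)
      show "a * lookup Q q * s \<in> ?CI" if "s \<in> ?S" for s
        using that PQ[of _ q] by (auto simp: mult_ac)
    qed (use p0 I in auto)

    have "lookup (P' * Q) k \<in> ?I" for k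
    proof -
      have "P' * Q = P * Q - Poly_Mapping.single p0 a * Q" by (simp add: P'_def algebra_simps)
      moreover have "lookup (Poly_Mapping.single p0 a * Q) k \<in> ?I"
        by (rule lookup_mult_in_ideal[OF I])
          (use aQ is_ideal_zero[OF I] in \<open>auto simp: lookup_single when_def\<close>)
      ultimately show ?thesis using is_ideal_diff[OF I coeff_I] by (simp only: lookup_minus)
    qed
    then have "ideal_gen (range (lookup (P' * Q))) \<subseteq> ?I"
      by (intro ideal_gen_least[OF I]) blast
    moreover have "lookup P' ` keys P' \<subseteq> H"
      using less.prems by (auto simp: lookup_P' keys_minus)
    ultimately have "lookup P' p * lookup Q q \<in> ?I"
      using less.hyps[OF lessP] by blast
    then show ?thesis using aQ[of q] by (cases "p = p0") (simp_all add: lookup_P' a_def)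
  qed
qed

section \<open>Homogeneous components\<close>

locale graded_domain =
  fixes Rg :: "'g::cancel_comm_monoid_add \<Rightarrow> 'a::idom set"
  assumes graded: "graded_idom Rg"
begin

lemma torsionfree: "torsionfree_quotient TYPE('g)"
  and Rg_zero: "0 \<in> Rg \<alpha>"
  and Rg_add: "x \<in> Rg \<alpha> \<Longrightarrow> y \<in> Rg \<alpha> \<Longrightarrow> x + y \<in> Rg \<alpha>"
  and Rg_uminus: "x \<in> Rg \<alpha> \<Longrightarrow> - x \<in> Rg \<alpha>"
  and Rg_mult: "x \<in> Rg \<alpha> \<Longrightarrow> y \<in> Rg \<beta> \<Longrightarrow> x * y \<in> Rg (\<alpha> + \<beta>)"
  using graded unfolding graded_idom_def by blast+

lemma Rg_sum: "(\<And>i. i \<in> F \<Longrightarrow> g i \<in> Rg \<alpha>) \<Longrightarrow> sum g F \<in> Rg \<alpha>"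
  by (induction F rule: infinite_finite_induct) (auto intro: Rg_zero Rg_add)

definition is_decomposition :: "'a \<Rightarrow> ('g \<Rightarrow> 'a) \<Rightarrow> bool" where
  "is_decomposition x c \<longleftrightarrow> finite {\<alpha>. c \<alpha> \<noteq> 0} \<and> (\<forall>\<alpha>. c \<alpha> \<in> Rg \<alpha>)
     \<and> x = (\<Sum>\<alpha>\<in>{\<alpha>. c \<alpha> \<noteq> 0}. c \<alpha>)"

lemma ex1_decomposition: "\<exists>!c. is_decomposition x c"
  using graded unfolding graded_idom_def is_decomposition_def by blast

lemma hcomp_eq_The: "hcomp Rg x = (THE c. is_decomposition x c)"
  by (simp only: hcomp_def is_decomposition_def)

lemma is_decomposition_hcomp: "is_decomposition x (hcomp Rg x)"
  unfolding hcomp_eq_The by (rule theI'[OF ex1_decomposition])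

lemma finite_hcomp: "finite {\<alpha>. hcomp Rg x \<alpha> \<noteq> 0}"
  and hcomp_in: "hcomp Rg x \<alpha> \<in> Rg \<alpha>"
  using is_decomposition_hcomp[of x] by (auto simp: is_decomposition_def)

lemma sum_hcomp:
  assumes "finite A" "\<And>\<alpha>. hcomp Rg x \<alpha> \<noteq> 0 \<Longrightarrow> \<alpha> \<in> A"
  shows "(\<Sum>\<alpha>\<in>A. hcomp Rg x \<alpha>) = x"
proof -
  have "(\<Sum>\<alpha>\<in>A. hcomp Rg x \<alpha>) = (\<Sum>\<alpha>\<in>{\<alpha>. hcomp Rg x \<alpha> \<noteq> 0}. hcomp Rg x \<alpha>)"
    by (rule sum.mono_neutral_right) (use assms in auto)
  then show ?thesis using is_decomposition_hcomp[of x] by (simp add: is_decomposition_def)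
qed

lemma hcomp_eqI:
  assumes "finite A" "\<And>\<alpha>. c \<alpha> \<noteq> 0 \<Longrightarrow> \<alpha> \<in> A" "\<And>\<alpha>. c \<alpha> \<in> Rg \<alpha>" "x = (\<Sum>\<alpha>\<in>A. c \<alpha>)"
  shows "hcomp Rg x = c"
proof -
  have "(\<Sum>\<alpha>\<in>A. c \<alpha>) = (\<Sum>\<alpha>\<in>{\<alpha>. c \<alpha> \<noteq> 0}. c \<alpha>)"
    by (rule sum.mono_neutral_right) (use assms in auto)
  moreover have "finite {\<alpha>. c \<alpha> \<noteq> 0}"
    by (rule finite_subset[OF _ assms(1)]) (use assms(2) in auto)
  ultimately have "is_decomposition x c"
    using assms by (simp add: is_decomposition_def)
  then show ?thesis unfolding hcomp_eq_The by (rule the1_equality[OF ex1_decomposition])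
qed

lemma hcomp_homogeneous:
  assumes "h \<in> Rg \<delta>"
  shows "hcomp Rg h \<alpha> = (if \<alpha> = \<delta> then h else 0)"
proof -
  have "hcomp Rg h = (\<lambda>\<alpha>. if \<alpha> = \<delta> then h else 0)"
    by (rule hcomp_eqI[of "{\<delta>}"]) (use assms in \<open>auto split: if_splits intro: Rg_zero\<close>)
  then show ?thesis by simp
qed

lemma hcomp_zero: "hcomp Rg 0 \<alpha> = 0"
  using hcomp_homogeneous[OF Rg_zero] by simp

lemma hcomp_add: "hcomp Rg (x + y) \<alpha> = hcomp Rg x \<alpha> + hcomp Rg y \<alpha>"
proof -
  let ?A = "{\<alpha>. hcomp Rg x \<alpha> \<noteq> 0} \<union> {\<alpha>. hcomp Rg y \<alpha> \<noteq> 0}"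
  have "hcomp Rg (x + y) = (\<lambda>\<alpha>. hcomp Rg x \<alpha> + hcomp Rg y \<alpha>)"
  proof (rule hcomp_eqI)
    show "finite ?A" by (simp add: finite_hcomp)
    then show "x + y = (\<Sum>\<alpha>\<in>?A. hcomp Rg x \<alpha> + hcomp Rg y \<alpha>)"
      by (simp add: sum.distrib sum_hcomp)
  qed (auto intro: Rg_add hcomp_in)
  then show ?thesis by simp
qed

text \<open>Multiplication by h shifts degrees by \<delta>, so each component of h * x is a sum of
  terms h * x_\<alpha>. The sum over \<delta> + \<alpha> = \<gamma> avoids \<gamma> - \<delta>,
  which need not exist in the monoid.\<close>

lemma dvd_hcomp_mult_homogeneous:
  assumes h: "h \<in> Rg \<delta>"
  shows "h dvd hcomp Rg (h * x) \<gamma>"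
proof -
  let ?A = "{\<alpha>. hcomp Rg x \<alpha> \<noteq> 0}"
  have "hcomp Rg (h * x) = (\<lambda>\<gamma>. \<Sum>\<alpha>\<in>?A. if \<delta> + \<alpha> = \<gamma> then h * hcomp Rg x \<alpha> else 0)"
  proof (rule hcomp_eqI)
    show "finite ((+) \<delta> ` ?A)" by (simp add: finite_hcomp)
    show "\<gamma> \<in> (+) \<delta> ` ?A"
      if nz: "(\<Sum>\<alpha>\<in>?A. if \<delta> + \<alpha> = \<gamma> then h * hcomp Rg x \<alpha> else 0) \<noteq> 0" for \<gamma>
    proof (rule ccontr)
      assume "\<gamma> \<notin> (+) \<delta> ` ?A"
      then have "(\<Sum>\<alpha>\<in>?A. if \<delta> + \<alpha> = \<gamma> then h * hcomp Rg x \<alpha> else 0) = 0"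
        by (intro sum.neutral) auto
      then show False using nz by contradiction
    qed
    show "(\<Sum>\<alpha>\<in>?A. if \<delta> + \<alpha> = \<gamma> then h * hcomp Rg x \<alpha> else 0) \<in> Rg \<gamma>" for \<gamma>
      by (rule Rg_sum) (auto intro: Rg_zero Rg_mult[OF h hcomp_in])
    have "(\<Sum>\<gamma>\<in>(+) \<delta> ` ?A. \<Sum>\<alpha>\<in>?A. if \<delta> + \<alpha> = \<gamma> then h * hcomp Rg x \<alpha> else 0)
        = (\<Sum>\<alpha>\<in>?A. h * hcomp Rg x \<alpha>)"
      by (subst sum.swap) (simp add: finite_hcomp)
    then show "h * x = (\<Sum>\<gamma>\<in>(+) \<delta> ` ?A. \<Sum>\<alpha>\<in>?A. if \<delta> + \<alpha> = \<gamma> then h * hcomp Rg x \<alpha> else 0)"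
      by (simp add: sum_distrib_left[symmetric] sum_hcomp finite_hcomp)
  qed
  then show ?thesis by (simp add: dvd_sum)
qed

text \<open>For homogeneous s, every component of a multiple of s is again a multiple of s.\<close>

lemma homogeneous_ideal_gen:
  assumes S: "S \<subseteq> (\<Union>\<alpha>. Rg \<alpha>)"
  shows "homogeneous_ideal Rg (ideal_gen S)"
proof -
  let ?I = "ideal_gen S"
  have I: "is_ideal ?I" by (rule is_ideal_ideal_gen)
  have "hcomp Rg x \<gamma> \<in> ?I" if x: "x \<in> ?I" for x \<gamma>
  proof -
    obtain F c where F: "finite F" "F \<subseteq> S" and sum: "x = (\<Sum>s\<in>F. c s * s)"
      using x unfolding ideal_gen_def by blast
    have "hcomp Rg (\<Sum>s\<in>F. c s * s) \<gamma> \<in> ?I"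
      using F
    proof (induction F rule: finite_induct)
      case empty
      then show ?case using is_ideal_zero[OF I] by (simp add: hcomp_zero)
    next
      case (insert s F)
      then obtain \<delta> where "s \<in> Rg \<delta>" using S by blast
      then have "s dvd hcomp Rg (c s * s) \<gamma>"
        using dvd_hcomp_mult_homogeneous by (simp add: mult.commute)
      moreover have "s \<in> ?I" using insert.prems by (auto intro: ideal_gen_superset)
      ultimately have "hcomp Rg (c s * s) \<gamma> \<in> ?I"
        using is_ideal_mult_right[OF I] by (auto simp: dvd_def)
      then show ?case using insert is_ideal_add[OF I] by (simp add: hcomp_add)
    qed
    then show ?thesis by (simp add: sum)
  qed
  then show ?thesis unfolding homogeneous_ideal_def using I by blast
qed

text \<open>The nonzero components of arbitrary generators lie in I by homogeneity and sum up to
  those generators.\<close>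

lemma homogeneous_generators:
  assumes I: "homogeneous_ideal Rg I" and fg: "fin_gen_ideal I"
  obtains T where "finite T" "T \<subseteq> (\<Union>\<alpha>. Rg \<alpha>) - {0}" "I = ideal_gen T"
proof -
  obtain S where S: "finite S" "I = ideal_gen S"
    using fg unfolding fin_gen_ideal_def by blast
  define T where "T = (\<Union>s\<in>S. hcomp Rg s ` {\<alpha>. hcomp Rg s \<alpha> \<noteq> 0})"
  have "T \<subseteq> I"
    using I ideal_gen_superset[of _ S] unfolding T_def homogeneous_ideal_def S(2) by blast
  then have "ideal_gen T \<subseteq> I"
    using I ideal_gen_least[of I T] unfolding homogeneous_ideal_def by blast
  moreover have "s \<in> ideal_gen T" if "s \<in> S" for s
  proof -
    have "(\<Sum>\<alpha>\<in>{\<alpha>. hcomp Rg s \<alpha> \<noteq> 0}. hcomp Rg s \<alpha>) \<in> ideal_gen T"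
      using that by (intro is_ideal_sum is_ideal_ideal_gen ideal_gen_superset) (auto simp: T_def)
    then show ?thesis by (simp add: sum_hcomp finite_hcomp)
  qed
  then have "I \<subseteq> ideal_gen T" unfolding S(2) by (intro ideal_gen_least is_ideal_ideal_gen) auto
  ultimately have "I = ideal_gen T" by blast
  moreover have "finite T" unfolding T_def using S(1) finite_hcomp by auto
  moreover have "T \<subseteq> (\<Union>\<alpha>. Rg \<alpha>) - {0}" unfolding T_def using hcomp_in by auto
  ultimately show thesis using that by blast
qed

section \<open>The ideal of all components of a polynomial\<close>

lemma A_ideal_least:
  assumes "is_ideal I" "\<And>i \<alpha>. hcomp Rg (coeff f i) \<alpha> \<in> I"
  shows "A_ideal Rg f \<subseteq> I"
  unfolding A_ideal_def by (rule ideal_gen_least) (use assms in auto)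

lemma hcomp_in_A_ideal: "hcomp Rg (coeff f i) \<alpha> \<in> A_ideal Rg f"
proof (cases "i \<le> degree f")
  case True
  then show ?thesis unfolding A_ideal_def by (intro ideal_gen_superset) auto
next
  case False
  then show ?thesis unfolding A_ideal_def
    using is_ideal_zero[OF is_ideal_ideal_gen] by (simp add: coeff_eq_0 hcomp_zero)
qed

lemma coeff_in_A_ideal: "coeff f i \<in> A_ideal Rg f"
proof -
  have "(\<Sum>\<alpha>\<in>{\<alpha>. hcomp Rg (coeff f i) \<alpha> \<noteq> 0}. hcomp Rg (coeff f i) \<alpha>) \<in> A_ideal Rg f"
    by (rule is_ideal_sum) (simp_all add: A_ideal_def is_ideal_ideal_gen hcomp_in_A_ideal[unfolded A_ideal_def])
  then show ?thesis by (simp add: sum_hcomp finite_hcomp)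
qed

lemma is_ideal_A_ideal: "is_ideal (A_ideal Rg f)"
  unfolding A_ideal_def by (rule is_ideal_ideal_gen)

text \<open>A polynomial is encoded by its bihomogeneous components, as an element of the monoid ring
  of \<open>\<nat> \<times> \<Gamma>\<close> over \<open>R\<close>; \<open>collapse\<close> is the ring homomorphism sending the basis element
  of index \<open>(i, \<alpha>)\<close> to \<open>X ^ i\<close>.\<close>

definition expand :: "'a poly \<Rightarrow> (nat \<times> 'g) \<Rightarrow>\<^sub>0 'a" where
  "expand f = Abs_poly_mapping (\<lambda>(i, \<alpha>). hcomp Rg (coeff f i) \<alpha>)"

definition bihomogeneous :: "((nat \<times> 'g) \<Rightarrow>\<^sub>0 'a) \<Rightarrow> bool" where
  "bihomogeneous P \<longleftrightarrow> (\<forall>i \<alpha>. lookup P (i, \<alpha>) \<in> Rg \<alpha>)"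

lemma lookup_expand: "lookup (expand f) (i, \<alpha>) = hcomp Rg (coeff f i) \<alpha>"
proof -
  have "{m. (case m of (i, \<alpha>) \<Rightarrow> hcomp Rg (coeff f i) \<alpha>) \<noteq> 0}
      \<subseteq> (SIGMA i:{..degree f}. {\<alpha>. hcomp Rg (coeff f i) \<alpha> \<noteq> 0})"
    by (auto simp: hcomp_zero) (metis coeff_eq_0 hcomp_zero not_le)
  then have "finite {m. (case m of (i, \<alpha>) \<Rightarrow> hcomp Rg (coeff f i) \<alpha>) \<noteq> 0}"
    by (rule finite_subset) (simp add: finite_hcomp)
  then show ?thesis unfolding expand_def by simp
qed

lemma bihomogeneous_expand: "bihomogeneous (expand f)"
  by (simp add: bihomogeneous_def lookup_expand hcomp_in)

text \<open>Lets \<open>expand_collapse\<close> apply to a product of expansions.\<close>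

lemma bihomogeneous_mult:
  assumes "bihomogeneous P" "bihomogeneous Q"
  shows "bihomogeneous (P * Q)"
  unfolding bihomogeneous_def
proof (intro allI)
  fix i \<alpha>
  show "lookup (P * Q) (i, \<alpha>) \<in> Rg \<alpha>"
  proof (rule lookup_mult_in)
    fix p q :: "nat \<times> 'g" assume "(i, \<alpha>) = p + q"
    then have "\<alpha> = snd p + snd q" by (metis snd_add snd_conv)
    then show "lookup P p * lookup Q q \<in> Rg \<alpha>"
      using Rg_mult assms unfolding bihomogeneous_def by (metis prod.collapse)
  qed (auto intro: Rg_zero Rg_add)
qed

definition collapse :: "((nat \<times> 'g) \<Rightarrow>\<^sub>0 'a) \<Rightarrow> 'a poly" where
  "collapse P = (\<Sum>m\<in>keys P. monom (lookup P m) (fst m))"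

lemma collapse_superset:
  assumes "finite A" "keys P \<subseteq> A"
  shows "collapse P = (\<Sum>m\<in>A. monom (lookup P m) (fst m))"
  unfolding collapse_def by (rule sum.mono_neutral_left) (use assms in \<open>auto simp: in_keys_iff\<close>)

lemma collapse_mult: "collapse (P * Q) = collapse P * collapse Q"
proof -
  let ?A = "(\<lambda>(p, q). p + q) ` (keys P \<times> keys Q)"
  have "keys (P * Q) \<subseteq> ?A" using keys_mult[of P Q] by force
  then have "collapse (P * Q) = (\<Sum>m\<in>?A. monom (lookup (P * Q) m) (fst m))"
    by (intro collapse_superset) auto
  also have "\<dots> = (\<Sum>m\<in>?A. \<Sum>p\<in>keys P. \<Sum>q\<in>keys Q.
      if m = p + q then monom (lookup P p * lookup Q q) (fst p + fst q) else 0)"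
    unfolding lookup_mult_sum monom_sum
    by (intro sum.cong refl) (auto simp: when_def)
  also have "\<dots> = (\<Sum>p\<in>keys P. \<Sum>m\<in>?A. \<Sum>q\<in>keys Q.
      if m = p + q then monom (lookup P p * lookup Q q) (fst p + fst q) else 0)"
    by (rule sum.swap)
  also have "\<dots> = (\<Sum>p\<in>keys P. \<Sum>q\<in>keys Q. \<Sum>m\<in>?A.
      if m = p + q then monom (lookup P p * lookup Q q) (fst p + fst q) else 0)"
    by (intro sum.cong refl sum.swap)
  also have "\<dots> = (\<Sum>p\<in>keys P. \<Sum>q\<in>keys Q. monom (lookup P p * lookup Q q) (fst p + fst q))"
    by (intro sum.cong refl) (auto simp: sum.delta)
  also have "\<dots> = collapse P * collapse Q"
    unfolding collapse_def sum_product by (simp add: mult_monom)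
  finally show ?thesis .
qed

lemma coeff_collapse:
  assumes "finite A" "\<And>\<alpha>. lookup P (i, \<alpha>) \<noteq> 0 \<Longrightarrow> \<alpha> \<in> A"
  shows "coeff (collapse P) i = (\<Sum>\<alpha>\<in>A. lookup P (i, \<alpha>))"
proof -
  have "coeff (collapse P) i = (\<Sum>m\<in>keys P. if fst m = i then lookup P m else 0)"
    by (simp add: collapse_def coeff_sum)
  also have "\<dots> = (\<Sum>m\<in>Pair i ` A. lookup P m)"
    by (rule sum.mono_neutral_cong) (use assms in \<open>auto simp: in_keys_iff\<close>)
  also have "\<dots> = (\<Sum>\<alpha>\<in>A. lookup P (i, \<alpha>))"
    by (subst sum.reindex) (auto simp: inj_on_def)
  finally show ?thesis .
qed

lemma collapse_expand: "collapse (expand f) = f"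
proof (rule poly_eqI)
  fix i
  have "coeff (collapse (expand f)) i
      = (\<Sum>\<alpha>\<in>{\<alpha>. hcomp Rg (coeff f i) \<alpha> \<noteq> 0}. lookup (expand f) (i, \<alpha>))"
    by (rule coeff_collapse) (auto simp: finite_hcomp lookup_expand)
  then show "coeff (collapse (expand f)) i = coeff f i"
    by (simp add: lookup_expand sum_hcomp finite_hcomp)
qed

text \<open>Uniqueness of the homogeneous decomposition: for fixed i the entries of P already form a
  decomposition of the i-th coefficient.\<close>

lemma expand_collapse:
  assumes P: "bihomogeneous P"
  shows "expand (collapse P) = P"
proof (rule poly_mapping_eqI)
  fix m :: "nat \<times> 'g"
  obtain i \<alpha> where m: "m = (i, \<alpha>)" by (cases m)
  have sub: "{\<alpha>. lookup P (i, \<alpha>) \<noteq> 0} \<subseteq> snd ` keys P"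
    by (force simp: in_keys_iff)
  then have fin: "finite {\<alpha>. lookup P (i, \<alpha>) \<noteq> 0}"
    by (rule finite_subset) simp
  have "hcomp Rg (coeff (collapse P) i) = (\<lambda>\<alpha>. lookup P (i, \<alpha>))"
    by (rule hcomp_eqI[OF fin]) (use P coeff_collapse[OF fin] in \<open>auto simp: bihomogeneous_def\<close>)
  then show "lookup (expand (collapse P)) m = lookup P m" by (simp add: m lookup_expand)
qed

text \<open>Both sides are bihomogeneous and collapse to f * g, so no component of a product of
  coefficients has to be computed.\<close>

lemma expand_mult: "expand (f * g) = expand f * expand g"
  using expand_collapse[OF bihomogeneous_mult[OF bihomogeneous_expand[of f] bihomogeneous_expand[of g]]]
  by (simp add: collapse_mult collapse_expand)

lemma A_ideal_eq_content: "A_ideal Rg f = ideal_gen (range (lookup (expand f)))"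
proof
  show "A_ideal Rg f \<subseteq> ideal_gen (range (lookup (expand f)))"
    by (rule A_ideal_least[OF is_ideal_ideal_gen])
      (simp only: lookup_expand[symmetric], rule ideal_gen_superset, simp)
  show "ideal_gen (range (lookup (expand f))) \<subseteq> A_ideal Rg f"
    by (rule ideal_gen_least[OF is_ideal_A_ideal]) (auto simp: lookup_expand hcomp_in_A_ideal)
qed

lemma torsionfree_nat_times: "torsionfree_quotient TYPE(nat \<times> 'g)"
proof -
  have "nsum_of n a = n * a" for n a :: nat by (simp add: nsum_of_def)
  then show ?thesis
    using torsionfree unfolding torsionfree_quotient_def by (auto simp: nsum_of_Pair)
qed

section \<open>The two implications\<close>

lemma A_ideal_mult_if_graded_Pruefer:
  assumes prufer: "graded_Pruefer Rg"
  shows "ideal_prod (A_ideal Rg f) (A_ideal Rg g) = A_ideal Rg (f * g)"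
proof
  show "A_ideal Rg (f * g) \<subseteq> ideal_prod (A_ideal Rg f) (A_ideal Rg g)"
    unfolding A_ideal_eq_content expand_mult
    by (rule ideal_gen_least[OF is_ideal_ideal_prod])
      (auto intro!: lookup_mult_in_ideal[OF is_ideal_ideal_prod] ideal_prodI ideal_gen_superset)
  \<comment> \<open>Here \<open>H\<close> is the set of homogeneous elements: finitely many nonzero
    ones generate a nonzero homogeneous ideal, which is invertible by hypothesis and hence
    cancellable.\<close>
  have cancel: "x \<in> K"
    if S: "finite S" "S \<noteq> {}" "S \<subseteq> (\<Union>\<alpha>. Rg \<alpha>) - {0}" and K: "is_ideal K"
      and x: "\<And>s. s \<in> S \<Longrightarrow> x * s \<in> ideal_prod (ideal_gen S) K" for S K x
  proof (rule invertible_ideal_cancel[OF _ K])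
    have "ideal_gen S \<noteq> {0}" using S(2,3) ideal_gen_superset[of _ S] by blast
    moreover have "fin_gen_ideal (ideal_gen S)" unfolding fin_gen_ideal_def using S(1) by blast
    moreover have "homogeneous_ideal Rg (ideal_gen S)"
      by (rule homogeneous_ideal_gen) (use S(3) in blast)
    ultimately show "invertible_ideal (ideal_gen S)"
      using prufer unfolding graded_Pruefer_def by blast
    show "x * i \<in> ideal_prod (ideal_gen S) K" if "i \<in> ideal_gen S" for i
      using ideal_gen_least[OF is_ideal_colon[OF is_ideal_ideal_prod], of S x] x that by blast
  qed
  show "ideal_prod (A_ideal Rg f) (A_ideal Rg g) \<subseteq> A_ideal Rg (f * g)"
    unfolding A_ideal_eq_content expand_mult
  proof (rule ideal_prod_gen_least[OF is_ideal_ideal_gen])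
    fix s t assume "s \<in> range (lookup (expand f))" "t \<in> range (lookup (expand g))"
    then obtain p q where "s = lookup (expand f) p" "t = lookup (expand g) q" by blast
    moreover have "lookup (expand f) p * lookup (expand g) q
        \<in> ideal_gen (range (lookup (expand f * expand g)))"
    proof (rule content_mult_if_cancellative[OF torsionfree_nat_times])
      show "lookup (expand f) ` keys (expand f) \<subseteq> (\<Union>\<alpha>. Rg \<alpha>)"
        using hcomp_in by (force simp: lookup_expand)
    qed (rule cancel)
    ultimately show "s * t \<in> ideal_gen (range (lookup (expand f * expand g)))" by simp
  qed
qed

text \<open>Multiplicativity for \<open>(a + b X) (a - b X)\<close> yields \<open>a b = r a\<^sup>2 + s b\<^sup>2\<close>. Then
  \<open>(a X - b) (a s X + s b - a) = a\<^sup>2 (s X\<^sup>2 - X + r)\<close> exhibits the inverse of \<open>(a, b)\<close>, because the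
  right-hand side has content \<open>(a\<^sup>2)\<close>.\<close>

lemma partition_if_A_ideal_mult:
  assumes mult: "\<And>f g. ideal_prod (A_ideal Rg f) (A_ideal Rg g) = A_ideal Rg (f * g)"
    and a: "a \<in> Rg \<alpha>" "a \<noteq> 0" and b: "b \<in> Rg \<beta>"
  shows "\<exists>e. a dvd e * b \<and> b dvd (1 - e) * a"
proof -
  have a2: "a * a \<in> Rg (\<alpha> + \<alpha>)" and b2: "b * b \<in> Rg (\<beta> + \<beta>)" using a b Rg_mult by auto
  have "a * b \<in> A_ideal Rg ([:a, b:] * [:a, - b:])"
    unfolding mult[symmetric]
    using ideal_prodI[OF coeff_in_A_ideal[of "[:a, b:]" 0] is_ideal_uminus[OF is_ideal_A_ideal coeff_in_A_ideal[of "[:a, - b:]" 1]]]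
    by simp
  moreover have "A_ideal Rg ([:a, b:] * [:a, - b:]) \<subseteq> {a * a * r + b * b * s | r s. r \<in> UNIV \<and> s \<in> UNIV}"
    (is "_ \<subseteq> ?I")
  proof (rule A_ideal_least)
    show I: "is_ideal ?I" by (rule is_ideal_pair) (simp add: is_ideal_def)
    have "a * a \<in> ?I" by (rule CollectI, rule exI[of _ 1], rule exI[of _ 0]) simp
    moreover have "- (b * b) \<in> ?I" by (rule CollectI, rule exI[of _ 0], rule exI[of _ "-1"]) simp
    moreover have "[:a, b:] * [:a, - b:] = [:a * a, 0, - (b * b):]" by simp
    ultimately show "hcomp Rg (coeff ([:a, b:] * [:a, - b:]) i) \<gamma> \<in> ?I" for i \<gamma>
      using hcomp_homogeneous[OF a2] hcomp_homogeneous[OF Rg_uminus[OF b2]] hcomp_zero is_ideal_zero[OF I]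
      by (simp only: coeff_pCons split: nat.split) simp
  qed
  ultimately obtain r s where rs: "a * b = a * a * r + b * b * s" by blast

  \<comment> \<open>By \<open>rs\<close> the fraction t = b / a is a root of s X^2 - X + r, which
    therefore factors as (X - t) (s X + s t - 1). Multiplying each factor by a gives [:- b, a:] and
    g.\<close>
  define g where "g = [:s * b - a, a * s:]"
  have fg: "[:- b, a:] * g = [:a * a * r, - (a * a), a * a * s:]"
  proof -
    have "[:- b, a:] * g = [:- b * (s * b - a), a * (s * b - a) - b * (a * s), a * (a * s):]"
      by (simp add: g_def)
    also have "- b * (s * b - a) = a * a * r" using rs by (simp add: algebra_simps)
    finally show ?thesis by (simp add: algebra_simps)
  qed
  have dvd: "a * a dvd x * y" if "x \<in> A_ideal Rg [:- b, a:]" "y \<in> A_ideal Rg g" for x y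
  proof -
    have I: "is_ideal {z. a * a dvd z * 1}" by (rule is_ideal_multiples)
    \<comment> \<open>As a * a is homogeneous, its divisibility of a coefficient passes to all
      components of that coefficient.\<close>
    have "A_ideal Rg ([:- b, a:] * g) \<subseteq> {z. a * a dvd z * 1}"
    proof (rule A_ideal_least[OF I])
      have "a * a dvd coeff ([:- b, a:] * g) i" for i
        unfolding fg by (simp add: coeff_pCons split: nat.split)
      then have "\<exists>q. coeff ([:- b, a:] * g) i = a * a * q" for i by (simp add: dvd_def)
      then show "hcomp Rg (coeff ([:- b, a:] * g) i) \<gamma> \<in> {z. a * a dvd z * 1}" for i \<gamma>
        using dvd_hcomp_mult_homogeneous[OF a2] by (metis mem_Collect_eq mult.right_neutral)
    qed
    then show ?thesis using ideal_prodI[OF that] unfolding mult by auto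
  qed
  have fa: "a \<in> A_ideal Rg [:- b, a:]" using coeff_in_A_ideal[of "[:- b, a:]" 1] by simp
  have fb: "b \<in> A_ideal Rg [:- b, a:]"
    using is_ideal_uminus[OF is_ideal_A_ideal coeff_in_A_ideal[of "[:- b, a:]" 0]] by simp
  let ?J = "A_ideal Rg g"
  have J: "is_ideal ?J" by (rule is_ideal_A_ideal)
  have "A_ideal Rg [:- b, a:] \<subseteq> {a * u + b * v | u v. u \<in> UNIV \<and> v \<in> UNIV}" (is "_ \<subseteq> ?L")
  proof (rule A_ideal_least)
    show L: "is_ideal ?L" by (rule is_ideal_pair) (simp add: is_ideal_def)
    have "a \<in> ?L" by (rule CollectI, rule exI[of _ 1], rule exI[of _ 0]) simp
    moreover have "- b \<in> ?L" by (rule CollectI, rule exI[of _ 0], rule exI[of _ "-1"]) simp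
    ultimately show "hcomp Rg (coeff [:- b, a:] i) \<gamma> \<in> ?L" for i \<gamma>
      using hcomp_homogeneous[OF a(1)] hcomp_homogeneous[OF Rg_uminus[OF b]] hcomp_zero is_ideal_zero[OF L]
      by (simp only: coeff_pCons split: nat.split) simp
  qed
  then have ab_J: "ideal_prod (A_ideal Rg [:- b, a:]) ?J \<subseteq> {a * u + b * v | u v. u \<in> ?J \<and> v \<in> ?J}"
  proof (intro ideal_prod_least is_ideal_pair J)
    fix x y assume "x \<in> A_ideal Rg [:- b, a:]" and y: "y \<in> ?J"
    then obtain u v where "x = a * u + b * v"
      using \<open>A_ideal Rg [:- b, a:] \<subseteq> ?L\<close> by blast
    then have "x * y = a * (u * y) + b * (v * y)" by (simp add: algebra_simps)
    then show "x * y \<in> {a * u + b * v | u v. u \<in> ?J \<and> v \<in> ?J}"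
      using is_ideal_mult[OF J y] by blast
  qed
  \<comment> \<open>The coefficient -1 of X in s X^2 - X + r makes the content all of (a * a), not
    merely a part of it.\<close>
  have "a * a \<in> A_ideal Rg ([:- b, a:] * g)"
    using is_ideal_uminus[OF is_ideal_A_ideal coeff_in_A_ideal[of "[:- b, a:] * g" 1]] unfolding fg by simp
  then obtain u v where uv: "a * a = a * u + b * v" and u: "u \<in> ?J" and v: "v \<in> ?J"
    using ab_J unfolding mult by blast
  \<comment> \<open>The weight e is u / a, which lies in R because a * a divides a * u; likewise w =
    v / a. Divisibility of b * u by a * a then gives that a divides e * b.\<close>
  obtain e where e: "u = a * e" using dvd[OF fa u] a(2) by (auto simp: dvd_def mult.assoc)
  obtain w where w: "v = a * w" using dvd[OF fa v] a(2) by (auto simp: dvd_def mult.assoc)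
  have "a * a = a * (a * e + b * w)" using uv by (simp add: e w algebra_simps)
  then have "a = a * e + b * w" using a(2) by simp
  then have "(1 - e) * a = b * w" by (simp add: algebra_simps)
  moreover have "a * a dvd a * (e * b)" using dvd[OF fb u] by (simp add: e mult_ac)
  then have "a dvd e * b" using a(2) by simp
  ultimately show ?thesis by (metis dvd_triv_left)
qed

lemma graded_Pruefer_if_A_ideal_mult:
  assumes "\<And>f g. ideal_prod (A_ideal Rg f) (A_ideal Rg g) = A_ideal Rg (f * g)"
  shows "graded_Pruefer Rg"
  unfolding graded_Pruefer_def
proof (intro allI impI, elim conjE)
  fix I assume I: "homogeneous_ideal Rg I" "fin_gen_ideal I" "I \<noteq> {0}"
  obtain T where T: "finite T" "T \<subseteq> (\<Union>\<alpha>. Rg \<alpha>) - {0}" "I = ideal_gen T"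
    using homogeneous_generators[OF I(1,2)] by blast
  have "T \<noteq> {}"
    using I(3) unfolding T(3) ideal_gen_def by auto
  show "invertible_ideal I"
    unfolding T(3)
  proof (rule invertible_ideal_gen[OF T(1) \<open>T \<noteq> {}\<close>])
    show "0 \<notin> T" using T(2) by blast
    fix a b assume "a \<in> T" "b \<in> T"
    then obtain \<alpha> \<beta> where "a \<in> Rg \<alpha>" "a \<noteq> 0" "b \<in> Rg \<beta>" using T(2) by blast
    then show "\<exists>e. a dvd e * b \<and> b dvd (1 - e) * a"
      by (rule partition_if_A_ideal_mult[OF assms])
  qed
qed

end

theorem theorem3p1:
  fixes Rg :: "'g::cancel_comm_monoid_add \<Rightarrow> 'a::idom set"
  assumes "graded_idom Rg"
  shows "graded_Pruefer Rg \<longleftrightarrow>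
         (\<forall>f g :: 'a poly. ideal_prod (A_ideal Rg f) (A_ideal Rg g) = A_ideal Rg (f * g))"
proof -
  interpret graded_domain Rg by (rule graded_domain.intro) (rule assms)
  show ?thesis
    using A_ideal_mult_if_graded_Pruefer graded_Pruefer_if_A_ideal_mult by blast
qed

end
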